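(* The idempotent barycenter map $\beta_{[0,1]^{\omega_1}}:I([0,1]^{\omega_1})\to[0,1]^{\omega_1}$ is not $0$-soft.
   Context: A compactum is a compact Hausdorff space; all maps are continuous. For a compactum $X$, $C(X)$ is the Banach space of real-valued continuous functions on $X$ with the sup-norm, and $c_X$ is the constant function with value $c\in\mathbb R$. $\omega_1$ is the first uncountable cardinal. Idempotent measures: write $\oplus$ for $\max$ and $\odot$ for $+$ (for functions, $\lambda\odot\varphi=\lambda_X+\varphi$ for $\lambda\in\mathbb R$, and $\psi\oplus\varphi=\max\{\psi,\varphi\}$ pointwise). An idempotent measure on $X$ is a functional $\mu:C(X)\to\mathbb R$ such that (1) $\mu(1_X)=1$; (2) $\mu(\lambda\odot\varphi)=\lambda\odot\mu(\varphi)$ for all $\lambda\in\mathbb R$, $\varphi\in C(X)$; (3) $\mu(\psi\oplus\varphi)=\mu(\psi)\oplus\mu(\varphi)$ for all $\psi,\varphi\in C(X)$. $IX$ is the set of all idempotent measures on $X$ with the subspace topology from the product $\mathbb R^{C(X)}$; it is a compactum. A subset $A\subset\mathbb R^T$ is Max-Plus convex if for all $a,b\in A$ and $\alpha\in[-\infty,0]$ the point $\alpha\odot a\oplus b$ (add $\alpha$ to every coordinate of $a$, then take the coordinatewise maximum with $b$; for $\alpha=-\infty$ this is $b$) belongs to $A$. The cube $[0,1]^{\omega_1}\subset\mathbb R^{\omega_1}$ is Max-Plus convex. For a compact Max-Plus convex $A\subset\mathbb R^T$, the idempotent barycenter map $\beta_A:I(A)\to A$ is the (well-defined, continuous) map given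 by $\mathrm{pr}_t(\beta_A(\mu))=\mu(\mathrm{pr}_t|_A)$ for $t\in T$, $\mu\in I(A)$, where $\mathrm{pr}_t:\mathbb R^T\to\mathbb R$ is the projection onto the $t$-th coordinate. A map $f:X\to Y$ is $0$-soft if for any $0$-dimensional paracompact space $Z$, any closed subspace $A$ of $Z$ and maps $\Phi:A\to X$, $\Psi:Z\to Y$ with $\Psi|A=f\circ\Phi$, there exists a map $G:Z\to X$ such that $G|A=\Phi$ and $\Psi=f\circ G$. *)

theory Defs
  imports "HOL-Analysis.Analysis"
begin

section \<open>Idempotent measures\<close>

text \<open>Functions on a space are represented by extensional functions on its carrier, so that
  equality in \<open>C(X)\<close> is equality of functions on \<open>topspace X\<close>.\<close>

definition cfun_space :: "'a topology \<Rightarrow> ('a \<Rightarrow> real) set" where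
  "cfun_space X = {\<phi> \<in> extensional (topspace X). continuous_map X euclideanreal \<phi>}"

definition const_cfun :: "'a topology \<Rightarrow> real \<Rightarrow> 'a \<Rightarrow> real" where
  "const_cfun X c = (\<lambda>x\<in>topspace X. c)"

definition maxplus_scale :: "'a topology \<Rightarrow> real \<Rightarrow> ('a \<Rightarrow> real) \<Rightarrow> 'a \<Rightarrow> real" where
  "maxplus_scale X c \<phi> = (\<lambda>x\<in>topspace X. const_cfun X c x + \<phi> x)"

definition maxplus_add :: "'a topology \<Rightarrow> ('a \<Rightarrow> real) \<Rightarrow> ('a \<Rightarrow> real) \<Rightarrow> 'a \<Rightarrow> real" where
  "maxplus_add X \<psi> \<phi> = (\<lambda>x\<in>topspace X. max (\<psi> x) (\<phi> x))"

definition idempotent_measure :: "'a topology \<Rightarrow> (('a \<Rightarrow> real) \<Rightarrow> real) \<Rightarrow> bool" where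
  "idempotent_measure X \<mu> \<longleftrightarrow>
     \<mu> \<in> extensional (cfun_space X) \<and>
     \<mu> (const_cfun X 1) = 1 \<and>
     (\<forall>c. \<forall>\<phi>\<in>cfun_space X. \<mu> (maxplus_scale X c \<phi>) = c + \<mu> \<phi>) \<and>
     (\<forall>\<psi>\<in>cfun_space X. \<forall>\<phi>\<in>cfun_space X. \<mu> (maxplus_add X \<psi> \<phi>) = max (\<mu> \<psi>) (\<mu> \<phi>))"

definition idempotent_space :: "'a topology \<Rightarrow> (('a \<Rightarrow> real) \<Rightarrow> real) topology" where
  "idempotent_space X =
     subtopology (powertop_real (cfun_space X)) {\<mu>. idempotent_measure X \<mu>}"

text \<open>The map \<open>\<beta>\<^sub>A\<close> for \<open>A\<close> a subset of the power of the reals with exponent \<open>T\<close>; it takes values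
  in \<open>A\<close> when \<open>A\<close> is compact and Max-Plus convex.\<close>

definition idempotent_barycenter ::
    "'t set \<Rightarrow> ('t \<Rightarrow> real) set \<Rightarrow> ((('t \<Rightarrow> real) \<Rightarrow> real) \<Rightarrow> real) \<Rightarrow> 't \<Rightarrow> real" where
  "idempotent_barycenter T A \<mu> = (\<lambda>t\<in>T. \<mu> (\<lambda>x\<in>A. x t))"

section \<open>The cube\<close>

definition omega1 :: "nat set set" where
  "omega1 = Field (cardSuc natLeq)"

definition unit_cube :: "'t set \<Rightarrow> ('t \<Rightarrow> real) set" where
  "unit_cube T = (\<Pi>\<^sub>E t\<in>T. {0..1})"

definition cube_space :: "'t set \<Rightarrow> ('t \<Rightarrow> real) topology" where
  "cube_space T = subtopology (powertop_real T) (unit_cube T)"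

lemma continuous_map_idempotent_barycenter_cube:
  "continuous_map (idempotent_space (cube_space T)) (cube_space T)
     (idempotent_barycenter T (unit_cube T))"
proof -
  let ?X = "cube_space T"
  let ?p = "\<lambda>t. \<lambda>x\<in>unit_cube T. x t"
  have top: "topspace ?X = unit_cube T"
    by (auto simp: cube_space_def unit_cube_def)
  have p: "?p t \<in> cfun_space ?X" if "t \<in> T" for t
  proof -
    have "continuous_map ?X euclideanreal (\<lambda>x. x t)"
      unfolding cube_space_def
      by (intro continuous_map_from_subtopology continuous_map_product_projection that)
    then have "continuous_map ?X euclideanreal (?p t)"
      by (rule continuous_map_eq) (simp add: top)
    then show ?thesis
      by (simp add: cfun_space_def top)
  qed
  have const: "const_cfun ?X c \<in> cfun_space ?X" for c
    by (auto simp: cfun_space_def const_cfun_def intro: continuous_map_eq [of _ _ "\<lambda>x. c"])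
  have bounds: "0 \<le> \<mu> (?p t) \<and> \<mu> (?p t) \<le> 1" if \<mu>: "idempotent_measure ?X \<mu>" and t: "t \<in> T" for \<mu> t
  proof -
    have "maxplus_scale ?X 1 (const_cfun ?X 0) = const_cfun ?X 1"
      by (auto simp: maxplus_scale_def const_cfun_def)
    then have "\<mu> (const_cfun ?X 0) = 0" "\<mu> (const_cfun ?X 1) = 1"
      using \<mu> const [of 0] unfolding idempotent_measure_def by (metis add_cancel_right_right)+
    moreover have "maxplus_add ?X (const_cfun ?X 0) (?p t) = ?p t"
      "maxplus_add ?X (?p t) (const_cfun ?X 1) = const_cfun ?X 1"
      using t by (auto simp: maxplus_add_def const_cfun_def top unit_cube_def PiE_iff max_def
          fun_eq_iff restrict_def intro: antisym)
    then have "\<mu> (?p t) = max (\<mu> (const_cfun ?X 0)) (\<mu> (?p t))"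
      "\<mu> (const_cfun ?X 1) = max (\<mu> (?p t)) (\<mu> (const_cfun ?X 1))"
      using \<mu> p [OF t] const unfolding idempotent_measure_def by metis+
    ultimately show ?thesis
      by linarith
  qed
  have "continuous_map (idempotent_space ?X) euclideanreal (\<lambda>\<mu>. \<mu> (?p t))" if "t \<in> T" for t
    unfolding idempotent_space_def
    by (intro continuous_map_from_subtopology continuous_map_product_projection p that)
  then have "continuous_map (idempotent_space ?X) (powertop_real T)
      (idempotent_barycenter T (unit_cube T))"
    by (auto simp: continuous_map_componentwise idempotent_barycenter_def)
  moreover have "idempotent_barycenter T (unit_cube T) \<mu> \<in> unit_cube T"
    if "\<mu> \<in> topspace (idempotent_space ?X)" for \<mu>
    using that bounds
    by (auto simp: idempotent_space_def idempotent_barycenter_def unit_cube_def)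
  ultimately show ?thesis
    by (subst (2) cube_space_def) (auto simp: continuous_map_in_subtopology)
qed

section \<open>0-soft maps\<close>

definition paracompact_Hausdorff_space :: "'a topology \<Rightarrow> bool" where
  "paracompact_Hausdorff_space Z \<longleftrightarrow>
     Hausdorff_space Z \<and>
     (\<forall>\<U>. (\<forall>U\<in>\<U>. openin Z U) \<and> \<Union>\<U> = topspace Z \<longrightarrow>
        (\<exists>\<V>. (\<forall>V\<in>\<V>. openin Z V \<and> (\<exists>U\<in>\<U>. V \<subseteq> U)) \<and> \<Union>\<V> = topspace Z \<and>
             locally_finite_in Z \<V>))"

text \<open>Dimension is the covering dimension: a nonempty space has dimension 0 iff every finite open
  cover has an open refinement of order 0, that is, one with pairwise disjoint members.\<close>

definition zero_dimensional_space :: "'a topology \<Rightarrow> bool" where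
  "zero_dimensional_space Z \<longleftrightarrow>
     topspace Z \<noteq> {} \<and>
     (\<forall>\<U>. finite \<U> \<and> (\<forall>U\<in>\<U>. openin Z U) \<and> \<Union>\<U> = topspace Z \<longrightarrow>
        (\<exists>\<V>. (\<forall>V\<in>\<V>. openin Z V \<and> (\<exists>U\<in>\<U>. V \<subseteq> U)) \<and> \<Union>\<V> = topspace Z \<and>
             pairwise disjnt \<V>))"

text \<open>A formula of HOL cannot quantify over types, so the type \<open>'z\<close> carrying the test spaces \<open>Z\<close> is
  a parameter. For a map between compacta of weight at most \<open>\<kappa>\<close> (\<open>\<kappa>\<close> infinite), every type \<open>'z\<close>
  with at least \<open>2\<^sup>\<kappa>\<close> elements gives the same notion, the one with unrestricted \<open>Z\<close>: by normality
  the data on \<open>(Z, A)\<close> extend to Stone-Cech compactifications, where Mardesic factorization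
  replaces \<open>Z\<close> by a closed subset of the Cantor cube of weight \<open>\<kappa>\<close>. For \<open>\<kappa> = \<omega>\<^sub>1\<close> the type
  \<open>nat set set\<close> is large enough: it contains the power set of \<open>omega1\<close>.

  Continuity of \<open>f\<close> is understood, not part of the predicate, so that a map cannot fail to be
  0-soft merely by being discontinuous.\<close>

definition zero_soft ::
    "'z itself \<Rightarrow> 'x topology \<Rightarrow> 'y topology \<Rightarrow> ('x \<Rightarrow> 'y) \<Rightarrow> bool" where
  "zero_soft _ X Y f \<longleftrightarrow>
     (\<forall>(Z :: 'z topology) A \<Phi> \<Psi>.
        paracompact_Hausdorff_space Z \<and> zero_dimensional_space Z \<and> closedin Z A \<and>
        continuous_map (subtopology Z A) X \<Phi> \<and> continuous_map Z Y \<Psi> \<and>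
        (\<forall>z\<in>A. \<Psi> z = f (\<Phi> z)) \<longrightarrow>
        (\<exists>G. continuous_map Z X G \<and> (\<forall>z\<in>A. G z = \<Phi> z) \<and>
             (\<forall>z\<in>topspace Z. \<Psi> z = f (G z))))"

end

theory Submission
  imports Defs
begin

text \<open>
  The barycenter map of a cube \<open>[0,1]\<^sup>T\<close> fails to be 0-soft for every uncountable \<open>T\<close>, for the
  following reason. The measure \<open>\<nu>\<^sub>d\<close> that charges the vertex \<open>(0, 0, \<dots>)\<close> with weight \<open>0\<close> and the
  vertex \<open>(1, 1, \<dots>)\<close> with weight \<open>- 1/2 - d\<close> has the constant barycenter \<open>1/2 - d\<close>, for
  \<open>0 \<le> d \<le> 1/2\<close>. As \<open>d\<close> tends to \<open>0\<close> these measures converge to \<open>\<nu>\<^sub>0\<close>, with barycenter \<open>1/2\<close>. Now take \<open>d > 0\<close>, raise the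
  barycenter of \<open>\<nu>\<^sub>d\<close> back to \<open>1/2\<close> in a single coordinate \<open>t\<close>, and ask for a measure \<open>\<mu>\<close> with this
  barycenter whose marginal in another coordinate \<open>s\<close> is still that of \<open>\<nu>\<^sub>d\<close>. What
  lies over \<open>x s = 1\<close> has weight at most \<open>- 1/2 - d\<close> and contributes less than \<open>1/2\<close> to the
  \<open>t\<close>-th coordinate of the barycenter, so \<open>\<mu>\<close> has to charge points with \<open>x s = 0\<close> and
  \<open>x t \<ge> 1/2\<close>. Hence \<open>\<mu>\<close> assigns at least \<open>1/2\<close> to the function \<open>x t - x s\<close>, to which \<open>\<nu>\<^sub>0\<close>
  assigns \<open>0\<close>: no such \<open>\<mu>\<close> are near \<open>\<nu>\<^sub>0\<close>, although the barycenters converge.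

  Instead of the exact marginal, one strict inequality about it is enough for the lower bound
  \<open>1/4\<close>, by \<open>idempotent_measure_cube_diff_ge\<close>; and a strict inequality persists near a point.

  To turn this into a failed lifting problem, the test space must force that inequality, while the
  lifting is prescribed only on a closed set where the barycenter is constant. Uncountability
  does this. The point \<open>Leaf n t\<close> of the test space carries the barycenter that is \<open>1/2\<close> at \<open>t\<close>
  and \<open>1/2 - depth\<close> elsewhere, where the depth depends only on \<open>n\<close> and tends to \<open>0\<close>. For fixed \<open>n\<close>
  the leaves converge, along cofinite sets of \<open>t\<close>, to a hub at which the lifting is prescribed as
  \<open>\<nu>\<^sub>d\<close> for this depth \<open>d\<close>, and the blocks of a hub with its leaves converge to an apex with \<open>\<nu>\<^sub>0\<close>.
  The inequality holds at each hub, hence at all but finitely many of its leaves. Only countably many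
  \<open>t\<close> are excluded in total, so some \<open>t\<close> serves all \<open>n\<close> at once, and the leaves \<open>Leaf n t\<close>
  converge to the apex. Along them a lifting would assign at least \<open>1/4\<close> to \<open>x t - x s\<close>, but at the
  apex it assigns \<open>0\<close>.
\<close>

section \<open>Ultraparacompact test spaces\<close>

definition ultraparacompact :: "'a topology \<Rightarrow> bool" where
  "ultraparacompact Z \<longleftrightarrow>
     (\<forall>\<U>. (\<forall>U\<in>\<U>. openin Z U) \<and> \<Union>\<U> = topspace Z \<longrightarrow>
        (\<exists>\<V>. (\<forall>V\<in>\<V>. openin Z V \<and> (\<exists>U\<in>\<U>. V \<subseteq> U)) \<and> \<Union>\<V> = topspace Z \<and>
             pairwise disjnt \<V>))"

text \<open>Each member of an open partition is a neighbourhood of its points that meets no other member.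
  Hence refining by partitions gives paracompactness and dimension 0 at the same time.\<close>

lemma locally_finite_in_open_partition:
  assumes "\<And>V. V \<in> \<V> \<Longrightarrow> openin Z V" "\<Union>\<V> = topspace Z" "pairwise disjnt \<V>"
  shows "locally_finite_in Z \<V>"
  unfolding locally_finite_in_def
proof (intro conjI ballI)
  fix x assume "x \<in> topspace Z"
  then obtain V where V: "V \<in> \<V>" "x \<in> V" using assms(2) by blast
  have "{U \<in> \<V>. U \<inter> V \<noteq> {}} \<subseteq> {V}"
    using assms(3) V by (auto simp: pairwise_def disjnt_def)
  then have "finite {U \<in> \<V>. U \<inter> V \<noteq> {}}" by (rule finite_subset) simp
  then show "\<exists>W. openin Z W \<and> x \<in> W \<and> finite {U \<in> \<V>. U \<inter> W \<noteq> {}}"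
    using V assms(1) by blast
qed (use assms in auto)

lemma ultraparacompact_imp_paracompact_Hausdorff:
  assumes "ultraparacompact Z" "Hausdorff_space Z"
  shows "paracompact_Hausdorff_space Z"
  unfolding paracompact_Hausdorff_space_def
proof (intro conjI allI impI)
  fix \<U> assume "(\<forall>U\<in>\<U>. openin Z U) \<and> \<Union>\<U> = topspace Z"
  then obtain \<V> where "\<forall>V\<in>\<V>. openin Z V \<and> (\<exists>U\<in>\<U>. V \<subseteq> U)" "\<Union>\<V> = topspace Z" "pairwise disjnt \<V>"
    using assms(1) unfolding ultraparacompact_def by meson
  then show "\<exists>\<V>. (\<forall>V\<in>\<V>. openin Z V \<and> (\<exists>U\<in>\<U>. V \<subseteq> U)) \<and> \<Union>\<V> = topspace Z \<and>
      locally_finite_in Z \<V>"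
    using locally_finite_in_open_partition[of \<V> Z] by blast
qed (rule assms)

lemma ultraparacompact_imp_zero_dimensional:
  assumes "ultraparacompact Z" "topspace Z \<noteq> {}"
  shows "zero_dimensional_space Z"
  using assms unfolding zero_dimensional_space_def ultraparacompact_def by meson

lemma ultraparacompact_homeomorphic_image:
  assumes e: "homeomorphic_map Z W e" and Z: "ultraparacompact Z"
  shows "ultraparacompact W"
  unfolding ultraparacompact_def
proof (intro allI impI)
  fix \<U> assume U: "(\<forall>U\<in>\<U>. openin W U) \<and> \<Union>\<U> = topspace W"
  have cont: "continuous_map Z W e" and img: "e ` topspace Z = topspace W"
    and inj: "inj_on e (topspace Z)" and opn: "open_map Z W e"
    using e by (auto simp: homeomorphic_eq_everything_map)
  let ?P = "(\<lambda>U. {z \<in> topspace Z. e z \<in> U}) ` \<U>"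
  have "\<forall>P\<in>?P. openin Z P"
    using U openin_continuous_map_preimage[OF cont] by blast
  moreover have "\<Union>?P = topspace Z"
  proof
    show "topspace Z \<subseteq> \<Union>?P"
    proof
      fix z assume z: "z \<in> topspace Z"
      then have "e z \<in> \<Union>\<U>" using U img by auto
      then show "z \<in> \<Union>?P" using z by auto
    qed
  qed auto
  ultimately obtain \<V> where V: "\<forall>V\<in>\<V>. openin Z V \<and> (\<exists>P\<in>?P. V \<subseteq> P)" "\<Union>\<V> = topspace Z"
    "pairwise disjnt \<V>"
    using Z unfolding ultraparacompact_def by meson
  have "openin W (e ` V)" "\<exists>U\<in>\<U>. e ` V \<subseteq> U" if "V \<in> \<V>" for V
  proof -
    show "openin W (e ` V)" using V(1) that opn by (simp add: open_map_def)
    obtain U where "U \<in> \<U>" "V \<subseteq> {z \<in> topspace Z. e z \<in> U}" using V(1) \<open>V \<in> \<V>\<close> by auto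
    then show "\<exists>U\<in>\<U>. e ` V \<subseteq> U" by (intro bexI[of _ U]) auto
  qed
  then have "\<forall>V\<in>(`) e ` \<V>. openin W V \<and> (\<exists>U\<in>\<U>. V \<subseteq> U)" by simp
  moreover have "\<Union>((`) e ` \<V>) = topspace W"
    by (simp only: image_Union[symmetric] V(2) img)
  moreover have "pairwise disjnt ((`) e ` \<V>)"
  proof -
    have "disjnt (e ` A) (e ` B)" if "A \<in> \<V>" "B \<in> \<V>" "A \<noteq> B" for A B
    proof -
      have "A \<inter> B = {}" using that V(3) by (auto simp: pairwise_def disjnt_def)
      moreover have "A \<subseteq> topspace Z" "B \<subseteq> topspace Z" using that V(2) by auto
      ultimately show ?thesis
        using inj_on_image_Int[OF inj, of A B] by (simp add: disjnt_def)
    qed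
    then show ?thesis by (auto simp: pairwise_def)
  qed
  ultimately show "\<exists>\<V>. (\<forall>V\<in>\<V>. openin W V \<and> (\<exists>U\<in>\<U>. V \<subseteq> U)) \<and> \<Union>\<V> = topspace W \<and>
      pairwise disjnt \<V>"
    by blast
qed

lemma homeomorphic_map_pullback_inv_into:
  assumes "inj_on e (topspace Z)"
  shows "homeomorphic_map Z
           (pullback_topology (e ` topspace Z) (inv_into (topspace Z) e) Z) e"
    (is "homeomorphic_map Z ?W e")
proof -
  have inv: "inv_into (topspace Z) e (e z) = z" if "z \<in> topspace Z" for z
    using assms that by (rule inv_into_f_f)
  have top: "topspace ?W = e ` topspace Z"
    by (auto simp: topspace_pullback_topology inv)
  have op: "openin ?W S \<longleftrightarrow> (\<exists>U. openin Z U \<and> S = e ` U)" for S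
  proof -
    have "inv_into (topspace Z) e -` U \<inter> e ` topspace Z = e ` U" if "openin Z U" for U
      using openin_subset[OF that] inv by force
    then show ?thesis by (metis openin_pullback_topology)
  qed
  have "continuous_map Z ?W e"
  proof -
    have "{z \<in> topspace Z. e z \<in> e ` U} = U" if "openin Z U" for U
      using openin_subset[OF that] assms by (auto dest: inj_onD)
    then show ?thesis by (auto simp: continuous_map top op)
  qed
  moreover have "open_map Z ?W e" by (auto simp: open_map_def op)
  ultimately show ?thesis
    using assms top by (simp add: bijective_open_imp_homeomorphic_map)
qed

text \<open>The type of the test spaces in \<open>zero_soft\<close> matters only through its cardinality: a test
  space on any type that embeds in it may be used.\<close>

lemma zero_soft_lift_ultraparacompact:
  fixes Z :: "'w topology" and e :: "'w \<Rightarrow> 'z"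
  assumes soft: "zero_soft TYPE('z) X Y f" and e: "inj_on e (topspace Z)"
    and Z: "ultraparacompact Z" "Hausdorff_space Z" "topspace Z \<noteq> {}"
    and A: "closedin Z A" and \<Phi>: "continuous_map (subtopology Z A) X \<Phi>"
    and \<Psi>: "continuous_map Z Y \<Psi>" and eq: "\<And>z. z \<in> A \<Longrightarrow> \<Psi> z = f (\<Phi> z)"
  obtains G where "continuous_map Z X G" "\<And>z. z \<in> A \<Longrightarrow> G z = \<Phi> z"
    "\<And>z. z \<in> topspace Z \<Longrightarrow> \<Psi> z = f (G z)"
proof -
  define W where "W = pullback_topology (e ` topspace Z) (inv_into (topspace Z) e) Z"
  have h: "homeomorphic_map Z W e"
    unfolding W_def by (rule homeomorphic_map_pullback_inv_into[OF e])
  then obtain g where "homeomorphic_maps Z W e g"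
    using homeomorphic_map_maps by blast
  then have ce: "continuous_map Z W e" and cg: "continuous_map W Z g"
    and ge: "\<And>z. z \<in> topspace Z \<Longrightarrow> g (e z) = z"
    by (auto simp: homeomorphic_maps_def)
  have AZ: "A \<subseteq> topspace Z" using A by (rule closedin_subset)
  have im: "e ` topspace Z = topspace W" using h by (rule homeomorphic_imp_surjective_map)
  have uW: "ultraparacompact W" using ultraparacompact_homeomorphic_image[OF h Z(1)] .
  have HW: "Hausdorff_space W"
    using Z(2) h homeomorphic_Hausdorff_space homeomorphic_space by blast
  have "topspace W \<noteq> {}" unfolding im[symmetric] using Z(3) by blast
  then have W: "paracompact_Hausdorff_space W" "zero_dimensional_space W"
    using ultraparacompact_imp_paracompact_Hausdorff[OF uW HW]
      ultraparacompact_imp_zero_dimensional[OF uW] by blast+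
  have cl: "closedin W (e ` A)"
    using homeomorphic_map_closedness[OF h AZ] A by blast
  have "continuous_map (subtopology W (e ` A)) (subtopology Z A) g"
    using AZ ge by (auto simp: continuous_map_in_subtopology image_iff subset_iff
        intro!: continuous_map_from_subtopology cg)
  then have \<Phi>W: "continuous_map (subtopology W (e ` A)) X (\<Phi> \<circ> g)"
    using \<Phi> by (rule continuous_map_compose)
  have \<Psi>W: "continuous_map W Y (\<Psi> \<circ> g)"
    using cg \<Psi> by (rule continuous_map_compose)
  have "\<forall>w\<in>e ` A. (\<Psi> \<circ> g) w = f ((\<Phi> \<circ> g) w)" using eq ge AZ by auto
  with W cl \<Phi>W \<Psi>W have "\<exists>G. continuous_map W X G \<and> (\<forall>w\<in>e ` A. G w = (\<Phi> \<circ> g) w) \<and>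
      (\<forall>w\<in>topspace W. (\<Psi> \<circ> g) w = f (G w))"
    by (intro soft[unfolded zero_soft_def, rule_format] conjI)
  then obtain G where "continuous_map W X G" "\<forall>w\<in>e ` A. G w = (\<Phi> \<circ> g) w"
    "\<forall>w\<in>topspace W. (\<Psi> \<circ> g) w = f (G w)"
    by blast
  note G = this
  show thesis
  proof (rule that[of "G \<circ> e"])
    show "continuous_map Z X (G \<circ> e)" using ce G(1) by (rule continuous_map_compose)
    show "(G \<circ> e) z = \<Phi> z" if "z \<in> A" for z
      using G(2) ge AZ that by auto
    show "\<Psi> z = f ((G \<circ> e) z)" if "z \<in> topspace Z" for z
    proof -
      have "e z \<in> topspace W" using im that by blast
      then have "(\<Psi> \<circ> g) (e z) = f (G (e z))" using G(3) by blast
      then show ?thesis by (simp add: ge[OF that])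
    qed
  qed
qed

section \<open>The fan\<close>

datatype 't fan = Apex | Hub nat | Leaf nat 't

definition openin_fan :: "'t fan set \<Rightarrow> bool" where
  "openin_fan U \<longleftrightarrow> (\<forall>n. Hub n \<in> U \<longrightarrow> finite {t. Leaf n t \<notin> U}) \<and>
     (Apex \<in> U \<longrightarrow> (\<exists>N. \<forall>n\<ge>N. Hub n \<in> U \<and> (\<forall>t. Leaf n t \<in> U)))"

definition fan_space :: "'t fan topology" where
  "fan_space = topology openin_fan"

lemma openin_fan_space: "openin fan_space = openin_fan"
proof -
  have "istopology openin_fan"
    unfolding istopology_def
  proof (intro conjI allI impI ballI)
    fix S T :: "'t fan set" assume ST: "openin_fan S" "openin_fan T"
    have "finite {t. Leaf n t \<notin> S \<inter> T}" if "Hub n \<in> S \<inter> T" for n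
    proof -
      have "{t. Leaf n t \<notin> S \<inter> T} = {t. Leaf n t \<notin> S} \<union> {t. Leaf n t \<notin> T}" by auto
      then show ?thesis using ST that by (simp add: openin_fan_def)
    qed
    moreover have "\<exists>N. \<forall>n\<ge>N. Hub n \<in> S \<inter> T \<and> (\<forall>t. Leaf n t \<in> S \<inter> T)" if "Apex \<in> S \<inter> T"
    proof -
      obtain M N where "\<forall>n\<ge>M. Hub n \<in> S \<and> (\<forall>t. Leaf n t \<in> S)"
        "\<forall>n\<ge>N. Hub n \<in> T \<and> (\<forall>t. Leaf n t \<in> T)"
        using ST \<open>Apex \<in> S \<inter> T\<close> unfolding openin_fan_def by blast
      then show ?thesis by (intro exI[of _ "max M N"]) auto
    qed
    ultimately show "openin_fan (S \<inter> T)" by (auto simp: openin_fan_def)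
  next
    fix \<K> :: "'t fan set set" assume K: "\<forall>K\<in>\<K>. openin_fan K"
    have "finite {t. Leaf n t \<notin> \<Union>\<K>}" if "Hub n \<in> \<Union>\<K>" for n
    proof -
      obtain K where k: "K \<in> \<K>" "Hub n \<in> K" using \<open>Hub n \<in> \<Union>\<K>\<close> by (rule UnionE)
      then have "finite {t. Leaf n t \<notin> K}" using K by (simp add: openin_fan_def)
      then show ?thesis by (rule rev_finite_subset) (use k in auto)
    qed
    moreover have "\<exists>N. \<forall>n\<ge>N. Hub n \<in> \<Union>\<K> \<and> (\<forall>t. Leaf n t \<in> \<Union>\<K>)" if "Apex \<in> \<Union>\<K>"
      using that K unfolding openin_fan_def by (meson UnionE UnionI)
    ultimately show "openin_fan (\<Union>\<K>)" by (auto simp: openin_fan_def)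
  qed
  then show ?thesis unfolding fan_space_def by (rule topology_inverse')
qed

lemma topspace_fan_space [simp]: "topspace fan_space = UNIV"
proof -
  have "openin fan_space UNIV" by (simp add: openin_fan_space openin_fan_def)
  then show ?thesis using openin_subset by blast
qed

lemma Hausdorff_fan_space: "Hausdorff_space (fan_space :: 't fan topology)"
  unfolding Hausdorff_space_def
proof (intro allI impI)
  fix x y :: "'t fan" assume "x \<in> topspace fan_space \<and> y \<in> topspace fan_space \<and> x \<noteq> y"
  then have "x \<noteq> y" by simp
  let ?B = "\<lambda>n. insert (Hub n) (range (Leaf n)) :: 't fan set"
  have leaf: "openin_fan {Leaf n t}" "openin_fan (- {Leaf n t})" for n and t :: 't
    by (auto simp: openin_fan_def intro!: exI[of _ "Suc n"])
  have block: "openin_fan (?B n)" "openin_fan (- ?B n)" for n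
    by (auto simp: openin_fan_def image_iff intro!: exI[of _ "Suc n"])
  have "\<exists>C. openin_fan C \<and> openin_fan (- C) \<and> (x \<in> C \<longleftrightarrow> y \<notin> C)"
  proof (cases "\<exists>n t. Leaf n t \<in> {x, y}")
    case True
    then obtain n t where "Leaf n t \<in> {x, y}" by blast
    then show ?thesis using leaf[of n t] \<open>x \<noteq> y\<close>
      by (intro exI[of _ "{Leaf n t}"]) auto
  next
    case False
    then obtain n where "Hub n \<in> {x, y}" using \<open>x \<noteq> y\<close> by (cases x; cases y) auto
    then show ?thesis using block[of n] \<open>x \<noteq> y\<close> False
      by (intro exI[of _ "?B n"]) auto
  qed
  then obtain C where C: "openin_fan C" "openin_fan (- C)" "x \<in> C \<longleftrightarrow> y \<notin> C" by blast
  define U where "U = (if x \<in> C then C else - C)"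
  have "openin_fan U" "openin_fan (- U)" "x \<in> U" "y \<in> - U"
    using C by (auto simp: U_def)
  then show "\<exists>U V. openin fan_space U \<and> openin fan_space V \<and> x \<in> U \<and> y \<in> V \<and> disjnt U V"
    by (intro exI[of _ U] exI[of _ "- U"]) (simp add: openin_fan_space disjnt_def)
qed

text \<open>A member of the cover around the apex contains all blocks from some \<open>N\<close> on. Each of the finitely
  many remaining blocks splits into the part lying in a member around its hub and isolated
  leaves.\<close>

lemma ultraparacompact_fan_space: "ultraparacompact (fan_space :: 't fan topology)"
  unfolding ultraparacompact_def
proof (intro allI impI)
  fix \<U> :: "'t fan set set"
  assume "(\<forall>U\<in>\<U>. openin fan_space U) \<and> \<Union>\<U> = topspace fan_space"
  then have U: "\<And>U. U \<in> \<U> \<Longrightarrow> openin_fan U" and cov: "\<And>z. \<exists>U. U \<in> \<U> \<and> z \<in> U"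
    by (auto simp: openin_fan_space)
  from cov obtain c where c: "\<And>z. c z \<in> \<U>" "\<And>z. z \<in> c z" by metis
  obtain N where N: "\<forall>n\<ge>N. Hub n \<in> c Apex \<and> (\<forall>t. Leaf n t \<in> c Apex)"
    using U[OF c(1)] c(2) unfolding openin_fan_def by blast
  let ?tail = "insert Apex (\<Union>n\<in>{N..}. insert (Hub n) (range (Leaf n)))"
  let ?near = "\<lambda>n. insert (Hub n) {Leaf n t |t. Leaf n t \<in> c (Hub n)}"
  define p where "p z = (case z of Apex \<Rightarrow> ?tail | Hub n \<Rightarrow> if N \<le> n then ?tail else ?near n
      | Leaf n t \<Rightarrow> if N \<le> n then ?tail else if Leaf n t \<in> c (Hub n) then ?near n else {Leaf n t})"
    for z
  have tail: "openin_fan ?tail"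
    by (auto simp: openin_fan_def image_iff)
  have near: "openin_fan (?near n)" for n
    using U[OF c(1)] c(2) by (auto simp: openin_fan_def)
  have single: "openin_fan {Leaf n t}" for n and t :: 't
    by (auto simp: openin_fan_def)
  have "openin_fan (p z)" for z
    using tail near single by (auto simp: p_def split: fan.split)
  moreover have "\<exists>U\<in>\<U>. p z \<subseteq> U" for z
  proof -
    have "?tail \<subseteq> c Apex" using N c(2) by auto
    moreover have "?near n \<subseteq> c (Hub n)" for n using c(2) by auto
    moreover have "{Leaf n t} \<subseteq> c (Leaf n t)" for n t using c(2) by auto
    ultimately show ?thesis
      using c(1) unfolding p_def by (cases z) (simp_all, meson+)
  qed
  moreover have "z \<in> p z" for z
    by (auto simp: p_def split: fan.split)
  moreover have "p w = p z" if "w \<in> p z" for w z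
    using that by (cases z; cases w) (auto simp: p_def split: if_splits)
  then have "pairwise disjnt (range p)"
    by (auto simp: pairwise_def disjnt_iff) blast+
  ultimately show "\<exists>\<V>. (\<forall>V\<in>\<V>. openin fan_space V \<and> (\<exists>U\<in>\<U>. V \<subseteq> U)) \<and>
      \<Union>\<V> = topspace fan_space \<and> pairwise disjnt \<V>"
    by (intro exI[of _ "range p"]) (auto simp: openin_fan_space)
qed

lemma closedin_fan_spine: "closedin fan_space (insert Apex (range Hub))"
proof -
  have "openin_fan (- insert Apex (range Hub))"
    by (auto simp: openin_fan_def)
  then show ?thesis by (simp add: closedin_def openin_fan_space Compl_eq_Diff_UNIV)
qed

text \<open>The bound \<open>1/2\<close> keeps the barycenter coordinates \<open>1/2 - depth z\<close> nonnegative.\<close>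

definition depth :: "'t fan \<Rightarrow> real" where
  "depth z = (case z of Apex \<Rightarrow> 0 | Hub n \<Rightarrow> inverse (2 * real (Suc n))
     | Leaf n t \<Rightarrow> inverse (2 * real (Suc n)))"

lemma depth_simps [simp]:
  "depth Apex = 0" "depth (Hub n) = inverse (2 * real (Suc n))"
  "depth (Leaf n t) = inverse (2 * real (Suc n))"
  by (simp_all add: depth_def)

lemma depth_bounds: "0 \<le> depth z" "depth z \<le> 1/2"
  by (cases z; simp add: field_simps)+

lemma continuous_map_fan_space:
  assumes hub: "\<And>n. finite {t. g (Leaf n t) \<noteq> g (Hub n)}"
    and apex: "\<And>z. \<bar>g z - g Apex\<bar> \<le> depth z"
  shows "continuous_map fan_space euclideanreal g"
  unfolding continuous_map
proof (intro conjI allI impI)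
  fix U :: "real set" assume "openin euclideanreal U"
  then have U: "open U" by simp
  have "finite {t. g (Leaf n t) \<notin> U}" if "g (Hub n) \<in> U" for n
    using hub[of n] by (rule rev_finite_subset) (use that in auto)
  moreover have "\<exists>N. \<forall>n\<ge>N. g (Hub n) \<in> U \<and> (\<forall>t. g (Leaf n t) \<in> U)" if A: "g Apex \<in> U"
  proof -
    obtain \<epsilon> where \<epsilon>: "\<epsilon> > 0" "\<And>y. \<bar>y - g Apex\<bar> < \<epsilon> \<Longrightarrow> y \<in> U"
      using U A unfolding open_dist dist_real_def by blast
    obtain N where N: "inverse (real (Suc N)) < \<epsilon>"
      using reals_Archimedean \<epsilon>(1) by blast
    have small: "inverse (2 * real (Suc n)) < \<epsilon>" if "N \<le> n" for n
    proof -
      have "inverse (2 * real (Suc n)) \<le> inverse (real (Suc N))"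
        using that by (intro le_imp_inverse_le) auto
      then show ?thesis using N by linarith
    qed
    have "g (Hub n) \<in> U \<and> (\<forall>t. g (Leaf n t) \<in> U)" if "N \<le> n" for n
      using apex[of "Hub n"] apex[of "Leaf n t" for t] small[OF that]
      by (auto intro!: \<epsilon>(2) order_le_less_trans[OF apex])
    then show ?thesis by blast
  qed
  ultimately show "openin fan_space {z \<in> topspace fan_space. g z \<in> U}"
    by (simp add: openin_fan_space openin_fan_def)
qed auto

lemma continuous_map_depth: "continuous_map fan_space euclideanreal depth"
  by (rule continuous_map_fan_space) (simp_all add: depth_bounds)

section \<open>Functions and measures\<close>

lemma restrict_mem_cfun_space:
  "continuous_map X euclideanreal \<phi> \<Longrightarrow> restrict \<phi> (topspace X) \<in> cfun_space X"
  by (auto simp: cfun_space_def intro: continuous_map_eq)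

lemma maxplus_scale_mem_cfun_space:
  assumes "\<phi> \<in> cfun_space X"
  shows "maxplus_scale X c \<phi> \<in> cfun_space X"
proof -
  have "continuous_map X euclideanreal (\<lambda>x. c + \<phi> x)"
    using assms by (intro continuous_intros) (auto simp: cfun_space_def)
  then have "(\<lambda>x\<in>topspace X. c + \<phi> x) \<in> cfun_space X"
    by (rule restrict_mem_cfun_space)
  moreover have "maxplus_scale X c \<phi> = (\<lambda>x\<in>topspace X. c + \<phi> x)"
    by (auto simp: maxplus_scale_def const_cfun_def)
  ultimately show ?thesis by simp
qed

lemma maxplus_add_mem_cfun_space:
  assumes "\<phi> \<in> cfun_space X" "\<psi> \<in> cfun_space X"
  shows "maxplus_add X \<phi> \<psi> \<in> cfun_space X"
  unfolding maxplus_add_def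
  by (intro restrict_mem_cfun_space continuous_intros) (use assms in \<open>auto simp: cfun_space_def\<close>)

lemma idempotent_measure_mono:
  assumes \<mu>: "idempotent_measure X \<mu>" and mem: "\<phi> \<in> cfun_space X" "\<psi> \<in> cfun_space X"
    and le: "\<And>x. x \<in> topspace X \<Longrightarrow> \<phi> x \<le> \<psi> x"
  shows "\<mu> \<phi> \<le> \<mu> \<psi>"
proof -
  have "maxplus_add X \<phi> \<psi> = \<psi>"
    using mem le by (fastforce simp: maxplus_add_def cfun_space_def extensional_def fun_eq_iff)
  then have "\<mu> \<psi> = max (\<mu> \<phi>) (\<mu> \<psi>)"
    using \<mu> mem unfolding idempotent_measure_def by metis
  then show ?thesis by linarith
qed

definition two_point_measure :: "'a topology \<Rightarrow> 'a \<Rightarrow> 'a \<Rightarrow> real \<Rightarrow> ('a \<Rightarrow> real) \<Rightarrow> real" where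
  "two_point_measure X a b c = (\<lambda>\<phi>\<in>cfun_space X. max (\<phi> a) (\<phi> b - c))"

lemma idempotent_measure_two_point:
  assumes "a \<in> topspace X" "b \<in> topspace X" "0 \<le> c"
  shows "idempotent_measure X (two_point_measure X a b c)"
proof -
  have "const_cfun X 1 \<in> cfun_space X"
    unfolding const_cfun_def by (intro restrict_mem_cfun_space) simp
  then have "two_point_measure X a b c (const_cfun X 1) = 1"
    using assms by (simp add: two_point_measure_def const_cfun_def)
  moreover have "two_point_measure X a b c (maxplus_scale X d \<phi>) = d + two_point_measure X a b c \<phi>"
    if "\<phi> \<in> cfun_space X" for d \<phi>
    using maxplus_scale_mem_cfun_space[OF that] that assms
    by (simp add: two_point_measure_def maxplus_scale_def const_cfun_def)
  moreover have "two_point_measure X a b c (maxplus_add X \<psi> \<phi>) =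
      max (two_point_measure X a b c \<psi>) (two_point_measure X a b c \<phi>)"
    if "\<psi> \<in> cfun_space X" "\<phi> \<in> cfun_space X" for \<psi> \<phi>
    using maxplus_add_mem_cfun_space[OF that] that assms
    by (simp add: two_point_measure_def maxplus_add_def)
  ultimately show ?thesis
    by (auto simp: idempotent_measure_def two_point_measure_def)
qed

lemma continuous_map_two_point_measure:
  assumes ab: "a \<in> topspace X" "b \<in> topspace X"
    and c: "continuous_map Z euclideanreal c" "\<And>z. z \<in> topspace Z \<Longrightarrow> 0 \<le> c z"
  shows "continuous_map Z (idempotent_space X) (\<lambda>z. two_point_measure X a b (c z))"
  unfolding idempotent_space_def continuous_map_in_subtopology continuous_map_componentwise
proof (intro conjI ballI)
  fix \<phi> assume "\<phi> \<in> cfun_space X"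
  then show "continuous_map Z euclideanreal (\<lambda>z. two_point_measure X a b (c z) \<phi>)"
    by (simp add: two_point_measure_def) (intro continuous_intros c)
next
  have "idempotent_measure X (two_point_measure X a b (c z))" if "z \<in> topspace Z" for z
    using ab c(2)[OF that] by (rule idempotent_measure_two_point)
  then show "(\<lambda>z. two_point_measure X a b (c z)) \<in> topspace Z \<rightarrow> {\<mu>. idempotent_measure X \<mu>}"
    by simp
qed (simp add: two_point_measure_def image_subset_iff)

lemma continuous_map_idempotent_space_eval:
  "\<phi> \<in> cfun_space X \<Longrightarrow> continuous_map (idempotent_space X) euclideanreal (\<lambda>\<mu>. \<mu> \<phi>)"
  unfolding idempotent_space_def
  by (intro continuous_map_from_subtopology continuous_map_product_projection)

lemma topspace_cube_space [simp]: "topspace (cube_space T) = unit_cube T"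
  by (auto simp: cube_space_def unit_cube_def)

lemma continuous_map_cube_proj:
  "t \<in> T \<Longrightarrow> continuous_map (cube_space T) euclideanreal (\<lambda>x. x t)"
  unfolding cube_space_def
  by (intro continuous_map_from_subtopology continuous_map_product_projection)

text \<open>By the bound \<open>1/2\<close> on the test function \<open>min 1 (4 * x s)\<close>, points with \<open>x s \<ge> 1/4\<close> contribute
  less than \<open>1/2\<close> to the \<open>t\<close>-th barycenter coordinate, so the value \<open>1/2\<close> of that coordinate must
  come from points with \<open>x s < 1/4\<close>, where \<open>x t\<close> exceeds \<open>x t - x s\<close> by less than \<open>1/4\<close>. Any
  cutoff strictly between \<open>0\<close> and \<open>1/2\<close> in place of \<open>1/4\<close> also yields a positive lower bound.\<close>

lemma idempotent_measure_cube_diff_ge: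
  assumes \<mu>: "idempotent_measure (cube_space T) \<mu>" and st: "s \<in> T" "t \<in> T"
    and small: "\<mu> (\<lambda>x\<in>unit_cube T. min 1 (4 * x s)) < 1/2"
    and bary: "\<mu> (\<lambda>x\<in>unit_cube T. x t) = 1/2"
  shows "1/4 \<le> \<mu> (\<lambda>x\<in>unit_cube T. x t - x s)"
proof -
  let ?X = "cube_space T"
  let ?g = "\<lambda>x\<in>unit_cube T. min 1 (4 * x s)" and ?d = "\<lambda>x\<in>unit_cube T. x t - x s"
    and ?p = "\<lambda>x\<in>unit_cube T. x t"
  have g: "?g \<in> cfun_space ?X"
    using restrict_mem_cfun_space[of ?X "\<lambda>x. min 1 (4 * x s)"] st
    by (simp add: continuous_map_cube_proj continuous_map_real_min continuous_map_real_mult_left)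
  have d: "?d \<in> cfun_space ?X"
    using restrict_mem_cfun_space[of ?X "\<lambda>x. x t - x s"] st
    by (simp add: continuous_map_cube_proj continuous_map_diff)
  have p: "?p \<in> cfun_space ?X"
    using restrict_mem_cfun_space[OF continuous_map_cube_proj[OF st(2)]] by simp
  let ?sd = "maxplus_scale ?X (1/4) ?d"
  have sd: "?sd \<in> cfun_space ?X" by (rule maxplus_scale_mem_cfun_space[OF d])
  have "\<mu> ?p \<le> \<mu> (maxplus_add ?X ?sd ?g)"
  proof (rule idempotent_measure_mono[OF \<mu> p maxplus_add_mem_cfun_space[OF sd g]])
    fix x assume "x \<in> topspace ?X"
    moreover from this have "x t \<le> 1" using st by (auto simp: unit_cube_def)
    ultimately show "?p x \<le> maxplus_add ?X ?sd ?g x"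
      by (auto simp: maxplus_add_def maxplus_scale_def const_cfun_def)
  qed
  also have "\<dots> = max (1/4 + \<mu> ?d) (\<mu> ?g)"
    using \<mu> sd g d unfolding idempotent_measure_def by simp
  finally show ?thesis using bary small by linarith
qed

section \<open>Failure of 0-softness\<close>

theorem not_zero_soft_barycenter_uncountable_cube:
  fixes T :: "'t set" and e :: "'t fan \<Rightarrow> 'z"
  assumes T: "uncountable T" and e: "inj e"
  shows "\<not> zero_soft TYPE('z) (idempotent_space (cube_space T)) (cube_space T)
           (idempotent_barycenter T (unit_cube T))"
proof
  let ?X = "cube_space T" and ?\<beta> = "idempotent_barycenter T (unit_cube T)"
  let ?A = "insert Apex (range Hub) :: 't fan set"
  assume soft: "zero_soft TYPE('z) (idempotent_space ?X) ?X ?\<beta>"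
  let ?o = "\<lambda>t\<in>T. 0 :: real" and ?i = "\<lambda>t\<in>T. 1 :: real"
  have vert: "?o \<in> topspace ?X" "?i \<in> topspace ?X" by (auto simp: unit_cube_def)
  define \<Phi> where "\<Phi> z = two_point_measure ?X ?o ?i (1/2 + depth z)" for z :: "'t fan"
  have \<Phi>_eval: "\<Phi> z (\<lambda>x\<in>unit_cube T. \<phi> x) = max (\<phi> ?o) (\<phi> ?i - (1/2 + depth z))"
    if "continuous_map ?X euclideanreal \<phi>" for \<phi> z
    using restrict_mem_cfun_space[OF that] vert by (simp add: \<Phi>_def two_point_measure_def)
  have \<Phi>: "continuous_map fan_space (idempotent_space ?X) \<Phi>"
    unfolding \<Phi>_def
    by (intro continuous_map_two_point_measure vert continuous_intros continuous_map_depth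
        add_nonneg_nonneg depth_bounds) simp_all
  \<comment> \<open>the amount by which the \<open>t\<close>-th coordinate of the barycenter at \<open>z\<close> stays below \<open>1/2\<close>\<close>
  define drop where "drop t z = (if \<exists>n. z = Leaf n t then 0 else depth z)" for t and z :: "'t fan"
  have drop_bounds: "0 \<le> drop t z" "drop t z \<le> 1/2" "drop t z \<le> depth z" for t z
    using depth_bounds[of z] by (auto simp: drop_def)
  define \<Psi> where "\<Psi> z = (\<lambda>t\<in>T. 1/2 - drop t z)" for z
  have "continuous_map fan_space euclideanreal (drop t)" for t
  proof (rule continuous_map_fan_space)
    show "finite {u. drop t (Leaf n u) \<noteq> drop t (Hub n)}" for n
      by (rule finite_subset[of _ "{t}"]) (auto simp: drop_def)
    have "drop t Apex = 0" by (simp add: drop_def)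
    then show "\<bar>drop t z - drop t Apex\<bar> \<le> depth z" for z
      using drop_bounds[of t z] by simp
  qed
  then have "continuous_map fan_space (powertop_real T) \<Psi>"
    unfolding \<Psi>_def continuous_map_componentwise
    by (auto intro!: continuous_intros)
  moreover have "\<Psi> z \<in> unit_cube T" for z
  proof -
    have "0 \<le> 1/2 - drop t z" "1/2 - drop t z \<le> 1" for t
      using drop_bounds(1,2)[of t z] by linarith+
    then show ?thesis by (simp add: \<Psi>_def unit_cube_def)
  qed
  ultimately have \<Psi>: "continuous_map fan_space ?X \<Psi>"
    by (auto simp: cube_space_def continuous_map_in_subtopology)
  have "\<Psi> z = ?\<beta> (\<Phi> z)" if "z \<in> ?A" for z
  proof
    fix t
    have "drop t z = depth z" using that by (auto simp: drop_def)
    then show "\<Psi> z t = ?\<beta> (\<Phi> z) t"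
      using \<Phi>_eval[OF continuous_map_cube_proj] depth_bounds[of z]
      by (simp add: \<Psi>_def idempotent_barycenter_def)
  qed
  then obtain G where G: "continuous_map fan_space (idempotent_space ?X) G"
    and GA: "\<And>z. z \<in> ?A \<Longrightarrow> G z = \<Phi> z" and G\<beta>: "\<And>z. \<Psi> z = ?\<beta> (G z)"
    using zero_soft_lift_ultraparacompact[OF soft, of e fan_space ?A \<Phi> \<Psi>] e
      ultraparacompact_fan_space Hausdorff_fan_space closedin_fan_spine
      continuous_map_from_subtopology[OF \<Phi>] \<Psi>
    by (auto intro: inj_on_subset)
  have Gmeas: "idempotent_measure ?X (G z)" for z
    using continuous_map_image_subset_topspace[OF G]
    by (simp add: idempotent_space_def image_subset_iff)
  have G_open: "openin_fan {z. G z (\<lambda>x\<in>unit_cube T. \<phi> x) < r}"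
    if \<phi>: "continuous_map ?X euclideanreal \<phi>" for \<phi> r
  proof -
    have "continuous_map fan_space euclideanreal (\<lambda>z. G z (\<lambda>x\<in>unit_cube T. \<phi> x))"
      using continuous_map_compose[OF G continuous_map_idempotent_space_eval,
          OF restrict_mem_cfun_space[OF \<phi>]] by (simp add: o_def)
    from openin_continuous_map_preimage[OF this, of "{..<r}"] show ?thesis
      by (simp add: openin_fan_space)
  qed
  \<comment> \<open>The test function is used in one fixed coordinate \<open>s\<close> only. Its value is below \<open>1/2\<close> at each
    hub, since the depth there is positive.\<close>
  obtain s where s: "s \<in> T" using T by (metis countable_empty ex_in_conv)
  let ?g = "\<lambda>x\<in>unit_cube T. min 1 (4 * x s)"
  have g: "continuous_map ?X euclideanreal (\<lambda>x. min 1 (4 * x s))"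
    using s by (intro continuous_intros continuous_map_cube_proj continuous_map_real_mult_left) auto
  have "finite {t. \<not> G (Leaf n t) ?g < 1/2}" for n
  proof -
    have "G (Hub n) ?g < 1/2"
      using \<Phi>_eval[OF g] GA[of "Hub n"] s by (simp add: max_def)
    then show ?thesis
      using G_open[OF g, of "1/2"] unfolding openin_fan_def by auto
  qed
  then have "countable (\<Union>n. {t. \<not> G (Leaf n t) ?g < 1/2})"
    by (intro countable_UN countable_finite countableI_type)
  then obtain t where t: "t \<in> T" "\<And>n. G (Leaf n t) ?g < 1/2"
  proof -
    have "\<not> T \<subseteq> (\<Union>n. {t. \<not> G (Leaf n t) ?g < 1/2})"
      using T \<open>countable _\<close> by (blast intro: countable_subset)
    then show ?thesis using that by blast
  qed
  let ?d = "\<lambda>x\<in>unit_cube T. x t - x s"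
  have d: "continuous_map ?X euclideanreal (\<lambda>x. x t - x s)"
    using s t by (intro continuous_intros continuous_map_cube_proj)
  have far: "1/4 \<le> G (Leaf n t) ?d" for n
  proof (rule idempotent_measure_cube_diff_ge[OF Gmeas s t(1) t(2)])
    show "G (Leaf n t) (\<lambda>x\<in>unit_cube T. x t) = 1/2"
      using fun_cong[OF G\<beta>[of "Leaf n t"], of t] t(1)
      by (simp add: \<Psi>_def drop_def idempotent_barycenter_def)
  qed
  have "G Apex ?d < 1/4"
    using \<Phi>_eval[OF d] GA[of Apex] s t(1) by simp
  then obtain n where "G (Leaf n t) ?d < 1/4"
    using G_open[OF d, of "1/4"] unfolding openin_fan_def by auto
  then show False using far[of n] by simp
qed

lemma uncountable_omega1: "uncountable omega1"
proof
  assume "countable omega1"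
  then obtain f :: "nat set \<Rightarrow> nat" where "inj_on f omega1" by (rule countableE)
  then have "(card_of omega1, card_of (UNIV :: nat set)) \<in> ordLeq"
    using card_of_ordLeq[of omega1 "UNIV :: nat set"] by blast
  then have "(card_of omega1, natLeq) \<in> ordLeq"
    using card_of_nat ordLeq_ordIso_trans by blast
  moreover have "(card_of omega1, cardSuc natLeq) \<in> ordIso"
    unfolding omega1_def by (intro card_of_Field_ordIso cardSuc_Card_order natLeq_Card_order)
  ultimately have "(cardSuc natLeq, natLeq) \<in> ordLeq"
    using ordIso_ordLeq_trans ordIso_symmetric by blast
  then show False
    using cardSuc_greater[OF natLeq_Card_order] not_ordLess_ordLeq by blast
qed

definition fan_code :: "nat set fan \<Rightarrow> nat set set" where
  "fan_code z = (case z of Apex \<Rightarrow> {} | Hub n \<Rightarrow> {{Suc n}}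
     | Leaf n t \<Rightarrow> {{Suc n}, insert 0 (Suc ` t)})"

lemma inj_fan_code: "inj fan_code"
proof (rule injI)
  fix x y :: "nat set fan" assume eq: "fan_code x = fan_code y"
  have hub: "{n. {Suc n} \<in> fan_code z} = (case z of Apex \<Rightarrow> {} | Hub n \<Rightarrow> {n} | Leaf n t \<Rightarrow> {n})"
    and leaf: "{u \<in> fan_code z. 0 \<in> u} = (case z of Leaf n t \<Rightarrow> {insert 0 (Suc ` t)} | _ \<Rightarrow> {})" for z
    by (auto simp: fan_code_def split: fan.splits)
  have "t = u" if "insert 0 (Suc ` t) = insert 0 (Suc ` u)" for t u :: "nat set"
  proof -
    have "Suc ` t = Suc ` u" using that by (metis Diff_insert_absorb image_iff nat.distinct(1))
    then show ?thesis by (simp add: inj_image_eq_iff)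
  qed
  then have c: "insert 0 (Suc ` t) = insert 0 (Suc ` u) \<longleftrightarrow> t = u" for t u :: "nat set" by blast
  show "x = y"
    using arg_cong[OF eq, of "\<lambda>S. {n. {Suc n} \<in> S}"] arg_cong[OF eq, of "\<lambda>S. {u \<in> S. 0 \<in> u}"]
    unfolding hub leaf by (cases x; cases y) (simp_all add: c)
qed

theorem theorem4p9:
  shows "\<not> zero_soft TYPE(nat set set)
           (idempotent_space (cube_space omega1)) (cube_space omega1)
           (idempotent_barycenter omega1 (unit_cube omega1))"
  by (rule not_zero_soft_barycenter_uncountable_cube[OF uncountable_omega1 inj_fan_code])

end
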